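(* Let $G$ be a parity game and $\mathcal M=(M,<,\bot,\top,\upharpoonright,+)$ a progress measure space whose truncation operator is canonical. Let $\mu:V\to M$ be a progress measure. Then $D_1(\mu)$ is a 1-dominion, and every $\mu$-coherent 1-strategy is winning for player 1 on $D_1(\mu)$ (i.e. its restriction to $D_1(\mu)$ witnesses that $D_1(\mu)$ is a 1-dominion).
   Context: Parity game: finite disjoint $V_0,V_1$ (positions of players 0,1), $V=V_0\cup V_1$, move relation $E\subseteq V\times V$ with $E(v)=\{w:(v,w)\in E\}\neq\emptyset$ for all $v$, priority function $p:V\to P$, $P\subset\mathbb{N}$ finite. A positional $\alpha$-strategy on $U\subseteq V$ is $\sigma:U\cap V_\alpha\to V$ with $(v,\sigma(v))\in E$; a strategy without qualifier is one on $V$. For strategies $\sigma_0,\sigma_1$ on $U$ and $v\in U$, the play from $v$ in $U$ is the maximal finite or infinite sequence of positions of $U$ starting at $v$ whose successor at a $V_\alpha$ position is given by $\sigma_\alpha$. The priority of an infinite play is the maximal priority occurring infinitely often. $U$ is an $\alpha$-dominion if there is an $\alpha$-strategy on $U$ such that for every $(1-\alpha)$-strategy on $U$ and $v\in U$ the play is infinite and its priority has parity $\alpha$. A measure space is $(M,<,\bot,\top,\upharpoonright,+)$ where $<$ is a strict total order on $M$ with minimum $\bot$ and maximum $\top$, and $\upharpoonright: M\times V\to M$ (written $\eta\upharpoonright_v$, truncation) and $+:M\times V\to M$ (stretch). Truncation is canonical if $\eta=\top$ iff $\eta\upharpoonright_v=\top$, and $\eta\le\eta'$ implies $\eta\upharpoonright_v\le\eta'\upharpoonright_v$.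 It is a progress measure space if for all $\eta\in M$, $v\in V$: (1) $\eta\upharpoonright_v<(\eta+v)\upharpoonright_v$ whenever $\eta\upharpoonright_v<\top$ and $p(v)$ is even; (2) $\eta\upharpoonright_u\le(\eta+v)\upharpoonright_u$ for all positions $u$ of even priority with $p(v)\le p(u)$. For $\mu:V\to M$: $D_0(\mu)=\{v:\mu(v)\upharpoonright_v=\top\}$, $D_1(\mu)=V\setminus D_0(\mu)$. $\mu$ is a progress measure if for all $v$: if $v\in V_0$ then $\mu(w)+v\le\mu(v)$ for all $w\in E(v)$; if $v\in V_1$ then $\mu(w)+v\le\mu(v)$ for some $w\in E(v)$. A 1-strategy $\sigma$ is $\mu$-coherent if $\mu(\sigma(v))+v\le\mu(v)$ for all $v\in V_1$.
   Formalization: The formal theorem additionally assumes ⊤+v=⊤ at positions v whose priority exceeds every even priority occurring in the game; without this the claim is false, since a play may leave D_1(μ) at such a v. At all other positions it follows from condition (2). *)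

theory Defs
  imports Main "HOL-Library.FuncSet"
begin

section \<open>Parity games\<close>

record 'v game =
  pos0 :: "'v set"
  pos1 :: "'v set"
  edges :: "('v \<times> 'v) set"
  prios :: "nat set"
  prio :: "'v \<Rightarrow> nat"

definition positions :: "'v game \<Rightarrow> 'v set" where
  "positions G = pos0 G \<union> pos1 G"

definition succs :: "'v game \<Rightarrow> 'v \<Rightarrow> 'v set" where
  "succs G v = {w. (v, w) \<in> edges G}"

definition parity_game :: "'v game \<Rightarrow> bool" where
  "parity_game G \<longleftrightarrow>
     finite (pos0 G) \<and> finite (pos1 G) \<and> pos0 G \<inter> pos1 G = {} \<and>
     edges G \<subseteq> positions G \<times> positions G \<and>
     (\<forall>v\<in>positions G. succs G v \<noteq> {}) \<and>
     finite (prios G) \<and> prio G \<in> positions G \<rightarrow> prios G"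

text \<open>Players are the numbers \<open>0\<close> and \<open>1\<close>; the opponent of \<open>\<alpha>\<close> is \<open>1 - \<alpha>\<close>.\<close>

definition owned :: "'v game \<Rightarrow> nat \<Rightarrow> 'v set" where
  "owned G \<alpha> = (if \<alpha> = 0 then pos0 G else pos1 G)"

definition strategies :: "'v game \<Rightarrow> nat \<Rightarrow> 'v set \<Rightarrow> ('v \<Rightarrow> 'v) set" where
  "strategies G \<alpha> U = (\<Pi>\<^sub>E v\<in>U \<inter> owned G \<alpha>. succs G v)"

text \<open>A play in \<open>U\<close> is a sequence of options. It is finite if it reaches \<open>None\<close>, which happens
  exactly when a strategy moves outside \<open>U\<close>; this makes the play maximal.\<close>

primrec play :: "'v game \<Rightarrow> 'v set \<Rightarrow> ('v \<Rightarrow> 'v) \<Rightarrow> ('v \<Rightarrow> 'v) \<Rightarrow> 'v \<Rightarrow> nat \<Rightarrow> 'v option" where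
  "play G U \<sigma>0 \<sigma>1 v 0 = Some v"
| "play G U \<sigma>0 \<sigma>1 v (Suc n) =
     (case play G U \<sigma>0 \<sigma>1 v n of
        None \<Rightarrow> None
      | Some x \<Rightarrow> (let y = (if x \<in> pos0 G then \<sigma>0 x else \<sigma>1 x) in if y \<in> U then Some y else None))"

definition infinite_play :: "(nat \<Rightarrow> 'v option) \<Rightarrow> bool" where
  "infinite_play \<pi> \<longleftrightarrow> (\<forall>n. \<pi> n \<noteq> None)"

definition play_priority :: "'v game \<Rightarrow> (nat \<Rightarrow> 'v option) \<Rightarrow> nat" where
  "play_priority G \<pi> = Max {q. \<exists>\<^sub>\<infinity>n. \<exists>x. \<pi> n = Some x \<and> prio G x = q}"

definition winning_on :: "'v game \<Rightarrow> nat \<Rightarrow> 'v set \<Rightarrow> ('v \<Rightarrow> 'v) \<Rightarrow> bool" where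
  "winning_on G \<alpha> U \<sigma> \<longleftrightarrow>
     \<sigma> \<in> strategies G \<alpha> U \<and>
     (\<forall>\<tau>\<in>strategies G (1 - \<alpha>) U. \<forall>v\<in>U.
        let \<pi> = play G U (if \<alpha> = 0 then \<sigma> else \<tau>) (if \<alpha> = 0 then \<tau> else \<sigma>) v
        in infinite_play \<pi> \<and> play_priority G \<pi> mod 2 = \<alpha>)"

definition dominion :: "'v game \<Rightarrow> nat \<Rightarrow> 'v set \<Rightarrow> bool" where
  "dominion G \<alpha> U \<longleftrightarrow> U \<subseteq> positions G \<and> (\<exists>\<sigma>. winning_on G \<alpha> U \<sigma>)"

section \<open>Measure spaces\<close>

text \<open>The carrier of a measure space is a type \<open>'m\<close> whose class instance supplies the total order,
  \<open>bot\<close> and \<open>top\<close>. Truncation \<open>tr\<close> and stretch \<open>st\<close> matter only at positions of the game.\<close>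

definition canonical_truncation ::
    "'v game \<Rightarrow> ('m::{linorder,order_bot,order_top} \<Rightarrow> 'v \<Rightarrow> 'm) \<Rightarrow> bool" where
  "canonical_truncation G tr \<longleftrightarrow>
     (\<forall>v\<in>positions G.
        (\<forall>\<eta>. \<eta> = top \<longleftrightarrow> tr \<eta> v = top) \<and>
        (\<forall>\<eta> \<eta>'. \<eta> \<le> \<eta>' \<longrightarrow> tr \<eta> v \<le> tr \<eta>' v))"

definition progress_measure_space ::
    "'v game \<Rightarrow> ('m::{linorder,order_bot,order_top} \<Rightarrow> 'v \<Rightarrow> 'm) \<Rightarrow> ('m \<Rightarrow> 'v \<Rightarrow> 'm) \<Rightarrow> bool" where
  "progress_measure_space G tr st \<longleftrightarrow>
     (\<forall>\<eta>. \<forall>v\<in>positions G.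
        (tr \<eta> v < top \<and> even (prio G v) \<longrightarrow> tr \<eta> v < tr (st \<eta> v) v) \<and>
        (\<forall>u\<in>positions G. even (prio G u) \<and> prio G v \<le> prio G u \<longrightarrow> tr \<eta> u \<le> tr (st \<eta> v) u))"

text \<open>For a canonical truncation, the second condition above forces \<open>st top v = top\<close> at every
  position \<open>v\<close> whose priority is bounded by that of some position of even priority. It says
  nothing at the remaining positions, where \<open>st top v\<close> could be any element; then a progress
  measure need not have its set of non-\<open>top\<close> positions closed under the moves it permits. The
  condition below is vacuous if the largest priority of the game is even.\<close>

definition top_stretch ::
    "'v game \<Rightarrow> ('m::{linorder,order_bot,order_top} \<Rightarrow> 'v \<Rightarrow> 'm) \<Rightarrow> bool" where
  "top_stretch G st \<longleftrightarrow>
     (\<forall>v\<in>positions G.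
        (\<forall>u\<in>positions G. even (prio G u) \<longrightarrow> prio G u < prio G v) \<longrightarrow> st top v = top)"

definition D0 ::
    "'v game \<Rightarrow> ('m::{linorder,order_bot,order_top} \<Rightarrow> 'v \<Rightarrow> 'm) \<Rightarrow> ('v \<Rightarrow> 'm) \<Rightarrow> 'v set" where
  "D0 G tr \<mu> = {v \<in> positions G. tr (\<mu> v) v = top}"

definition D1 ::
    "'v game \<Rightarrow> ('m::{linorder,order_bot,order_top} \<Rightarrow> 'v \<Rightarrow> 'm) \<Rightarrow> ('v \<Rightarrow> 'm) \<Rightarrow> 'v set" where
  "D1 G tr \<mu> = positions G - D0 G tr \<mu>"

definition progress_measure ::
    "'v game \<Rightarrow> ('m::{linorder,order_bot,order_top} \<Rightarrow> 'v \<Rightarrow> 'm) \<Rightarrow> ('v \<Rightarrow> 'm) \<Rightarrow> bool" where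
  "progress_measure G st \<mu> \<longleftrightarrow>
     (\<forall>v\<in>pos0 G. \<forall>w\<in>succs G v. st (\<mu> w) v \<le> \<mu> v) \<and>
     (\<forall>v\<in>pos1 G. \<exists>w\<in>succs G v. st (\<mu> w) v \<le> \<mu> v)"

definition coherent ::
    "'v game \<Rightarrow> ('m::{linorder,order_bot,order_top} \<Rightarrow> 'v \<Rightarrow> 'm) \<Rightarrow> ('v \<Rightarrow> 'm) \<Rightarrow> ('v \<Rightarrow> 'v) \<Rightarrow> bool" where
  "coherent G st \<mu> \<sigma> \<longleftrightarrow>
     \<sigma> \<in> strategies G 1 (positions G) \<and> (\<forall>v\<in>pos1 G. st (\<mu> (\<sigma> v)) v \<le> \<mu> v)"

end

theory Submission
  imports Defs "HOL-Library.Infinite_Set"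
begin

text \<open>An edge along which the measure progresses stays in the set of non-\<open>top\<close> positions, so plays
  consistent with a coherent strategy never leave it. Suppose the dominating priority of such a play
  were even, attained at \<open>u\<close>. From some point on every step weakly decreases the measure truncated
  at \<open>u\<close>, and each visit of \<open>u\<close> decreases it strictly. Hence two successive visits of \<open>u\<close> would
  give its truncated measure two different values; no well-foundedness is needed.\<close>

text \<open>A value taken only finitely often is eventually avoided; as there are finitely many such
  values, a single tail of the sequence avoids all of them.\<close>

lemma eventually_recurrent:
  fixes x :: "nat \<Rightarrow> 'a"
  assumes "finite A" "\<And>n. x n \<in> A"
  shows "\<forall>\<^sub>\<infinity>n. \<exists>\<^sub>\<infinity>m. x m = x n"
proof -
  let ?B = "{u \<in> A. \<not> (\<exists>\<^sub>\<infinity>m. x m = u)}"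
  have "\<forall>\<^sub>\<infinity>m. \<forall>u\<in>?B. x m \<noteq> u"
    using \<open>finite A\<close> by (subst eventually_ball_finite_distrib) (auto simp: not_frequently)
  then show ?thesis
    by (rule eventually_mono) (use assms(2) in blast)
qed

text \<open>Passes from a recurring priority to a single recurring position, at which measures can
  then be truncated. Finiteness of \<open>A\<close> also ensures that the \<open>Max\<close> is
  taken over a finite nonempty set.\<close>

lemma Max_recurrent_attained:
  fixes x :: "nat \<Rightarrow> 'a" and p :: "'a \<Rightarrow> nat"
  assumes "finite A" "\<And>n. x n \<in> A"
  defines "q \<equiv> Max {q. \<exists>\<^sub>\<infinity>n. p (x n) = q}"
  obtains u where "\<exists>\<^sub>\<infinity>n. x n = u" "p u = q" "\<forall>\<^sub>\<infinity>n. p (x n) \<le> q"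
proof -
  let ?S = "{q. \<exists>\<^sub>\<infinity>n. p (x n) = q}"
  have "?S \<subseteq> p ` A"
    using assms(2) by (auto dest!: frequently_ex)
  then have fin: "finite ?S"
    using \<open>finite A\<close> finite_surj by blast
  have rec: "\<forall>\<^sub>\<infinity>n. \<exists>\<^sub>\<infinity>m. x m = x n"
    by (rule eventually_recurrent[OF assms(1,2)])
  have in_S: "p (x n) \<in> ?S" if "\<exists>\<^sub>\<infinity>m. x m = x n" for n
    using that by (auto elim: frequently_elim1)
  have "?S \<noteq> {}"
    using eventually_happens[OF rec] in_S by auto
  then have "q \<in> ?S"
    unfolding q_def using fin by (rule Max_in[rotated])
  then have "\<exists>\<^sub>\<infinity>n. p (x n) = q"
    by simp
  \<comment> \<open>Priority \<open>q\<close> occurs infinitely often and all but finitely many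
    indices carry recurrent positions, so some index does both.\<close>
  then obtain n where "p (x n) = q" "\<exists>\<^sub>\<infinity>m. x m = x n"
    using frequently_ex[OF frequently_eventually_frequently[OF _ rec]] by blast
  moreover have "\<forall>\<^sub>\<infinity>n. p (x n) \<le> q"
    using rec by (rule eventually_mono) (use in_S fin in \<open>auto simp: q_def\<close>)
  ultimately show thesis
    using that by blast
qed

lemma finite_positions: "parity_game G \<Longrightarrow> finite (positions G)"
  by (simp add: parity_game_def positions_def)

lemma succs_subset_positions: "parity_game G \<Longrightarrow> succs G v \<subseteq> positions G"
  by (auto simp: parity_game_def succs_def)

lemma play_priority_Some:
  assumes "\<And>n. \<pi> n = Some (x n)"
  shows "play_priority G \<pi> = Max {q. \<exists>\<^sub>\<infinity>n. prio G (x n) = q}"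
  by (simp add: play_priority_def assms)

lemma tr_eq_top_iff:
  "canonical_truncation G tr \<Longrightarrow> v \<in> positions G \<Longrightarrow> tr \<eta> v = top \<longleftrightarrow> \<eta> = top"
  unfolding canonical_truncation_def by blast

lemma tr_mono:
  "canonical_truncation G tr \<Longrightarrow> v \<in> positions G \<Longrightarrow> \<eta> \<le> \<eta>' \<Longrightarrow> tr \<eta> v \<le> tr \<eta>' v"
  unfolding canonical_truncation_def by blast

text \<open>If an even priority at some \<open>u\<close> bounds that of \<open>v\<close>, the second
  condition on the space, taken at \<open>top\<close>, makes the truncation of
  \<open>st top v\<close> at \<open>u\<close> equal to \<open>top\<close>, and canonicity removes
  the truncation. \<open>top_stretch\<close> supplies the other case.\<close>

lemma st_top:
  assumes "progress_measure_space G tr st" "canonical_truncation G tr" "top_stretch G st"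
    and "v \<in> positions G"
  shows "st top v = top"
proof (cases "\<forall>u\<in>positions G. even (prio G u) \<longrightarrow> prio G u < prio G v")
  case True
  then show ?thesis
    using assms by (simp add: top_stretch_def)
next
  case False
  then obtain u where u: "u \<in> positions G" "even (prio G u)" "prio G v \<le> prio G u"
    by (auto simp: not_less)
  then have "tr top u \<le> tr (st top v) u"
    using assms(1,4) by (simp add: progress_measure_space_def)
  then show ?thesis
    using tr_eq_top_iff[OF assms(2) u(1)] by (metis top.extremum_unique)
qed

lemma D1_iff:
  assumes "canonical_truncation G tr"
  shows "v \<in> D1 G tr \<mu> \<longleftrightarrow> v \<in> positions G \<and> \<mu> v \<noteq> top"
  by (auto simp: D1_def D0_def tr_eq_top_iff[OF assms])

text \<open>By contraposition: \<open>\<mu> w = top\<close> would push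
  \<open>st (\<mu> w) v\<close>, and with it \<open>\<mu> v\<close>, up to
  \<open>top\<close>.\<close>

lemma D1_step:
  assumes "progress_measure_space G tr st" "canonical_truncation G tr" "top_stretch G st"
    and "v \<in> D1 G tr \<mu>" "w \<in> positions G" "st (\<mu> w) v \<le> \<mu> v"
  shows "w \<in> D1 G tr \<mu>"
  using assms(4-6) st_top[OF assms(1-3), of v]
  by (auto simp: D1_iff[OF assms(2)] top_unique)

lemma progressing_path_odd:
  assumes "parity_game G" "progress_measure_space G tr st" "canonical_truncation G tr"
    and D1: "\<And>n. x n \<in> D1 G tr \<mu>"
    and step: "\<And>n. st (\<mu> (x (Suc n))) (x n) \<le> \<mu> (x n)"
  shows "odd (Max {q. \<exists>\<^sub>\<infinity>n. prio G (x n) = q})"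
proof
  assume even: "even (Max {q. \<exists>\<^sub>\<infinity>n. prio G (x n) = q})"
  note D1 = D1[unfolded D1_iff[OF assms(3)]]
  obtain u where rec: "\<exists>\<^sub>\<infinity>n. x n = u" and bound: "\<forall>\<^sub>\<infinity>n. prio G (x n) \<le> prio G u"
      and "even (prio G u)"
    using Max_recurrent_attained[of "positions G" x "prio G"] even D1
      finite_positions[OF assms(1)] by metis
  obtain N where N: "\<And>n. n \<ge> N \<Longrightarrow> prio G (x n) \<le> prio G u"
    using bound by (auto simp: MOST_nat_le)
  obtain n where n: "n \<ge> N" "x n = u"
    using rec by (auto simp: INFM_nat_le)
  \<comment> \<open>Starting at \<open>Suc n\<close> keeps the strict step out of \<open>u\<close>
    at time \<open>n\<close> before the return to \<open>u\<close>.\<close>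
  obtain m where m: "m \<ge> Suc n" "x m = u"
    using rec by (auto simp: INFM_nat_le)
  have u: "u \<in> positions G"
    using D1[of n] n by simp
  have dec: "tr (\<mu> (x (Suc k))) u \<le> tr (\<mu> (x k)) u" if "k \<ge> N" for k
  proof -
    have "tr (\<mu> (x (Suc k))) u \<le> tr (st (\<mu> (x (Suc k))) (x k)) u"
      using assms(2) u D1[of k] N[OF that] \<open>even (prio G u)\<close>
      by (simp add: progress_measure_space_def)
    also have "\<dots> \<le> tr (\<mu> (x k)) u"
      by (rule tr_mono[OF assms(3) u step])
    finally show ?thesis .
  qed
  \<comment> \<open>For a canonical truncation, being below \<open>top\<close> does not depend on
    the position of truncation, so membership of \<open>x (Suc n)\<close> in \<open>D1\<close> can
    be used at \<open>u\<close>.\<close>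
  have "tr (\<mu> (x (Suc n))) u \<noteq> top"
    using D1[of "Suc n"] by (simp add: tr_eq_top_iff[OF assms(3) u])
  then have "tr (\<mu> (x (Suc n))) u < tr (st (\<mu> (x (Suc n))) u) u"
    using assms(2) u \<open>even (prio G u)\<close>
    by (simp add: progress_measure_space_def top.not_eq_extremum)
  also have "\<dots> \<le> tr (\<mu> u) u"
    using tr_mono[OF assms(3) u step[of n]] n by simp
  \<comment> \<open>Since \<open>u = x m\<close>, the weak decreases from \<open>Suc n\<close> to
    \<open>m\<close> close the chain into a strict cycle.\<close>
  also have "\<dots> \<le> tr (\<mu> (x (Suc n))) u"
  proof -
    have "tr (\<mu> (x m)) u \<le> tr (\<mu> (x (Suc n))) u"
      using m(1)
    proof (induction m rule: dec_induct)
      case (step k)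
      then show ?case
        using dec[of k] n(1) by simp
    qed simp
    then show ?thesis
      using m(2) by simp
  qed
  finally show False
    by simp
qed

lemma coherent_winning:
  assumes "parity_game G" "progress_measure_space G tr st" "canonical_truncation G tr"
    and "top_stretch G st" "progress_measure G st \<mu>" "coherent G st \<mu> \<sigma>"
  defines "U \<equiv> D1 G tr \<mu>"
  shows "winning_on G 1 U (restrict \<sigma> (U \<inter> owned G 1))"
proof -
  let ?\<sigma> = "restrict \<sigma> (U \<inter> owned G 1)"
  have U_sub: "U \<subseteq> positions G"
    by (simp add: U_def D1_def)
  have \<sigma>: "\<sigma> v \<in> succs G v" "st (\<mu> (\<sigma> v)) v \<le> \<mu> v" if "v \<in> pos1 G" for v
    using assms(6) that
    by (auto simp: coherent_def strategies_def owned_def positions_def)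
  have "?\<sigma> \<in> strategies G 1 U"
    using \<sigma>(1) by (auto simp: strategies_def owned_def)
  moreover have "infinite_play (play G U \<tau> ?\<sigma> v) \<and> play_priority G (play G U \<tau> ?\<sigma> v) mod 2 = 1"
    if \<tau>: "\<tau> \<in> strategies G 0 U" and "v \<in> U" for \<tau> v
  proof -
    \<comment> \<open>Fixing both strategies makes the play the orbit of one map; once
      \<open>f\<close> preserves \<open>U\<close>, the play never reaches
      \<open>None\<close>.\<close>
    define f where "f y = (if y \<in> pos0 G then \<tau> y else ?\<sigma> y)" for y
    define x where "x n = (f ^^ n) v" for n
    have f_succ: "f y \<in> succs G y" and f_step: "st (\<mu> (f y)) y \<le> \<mu> y" if "y \<in> U" for y
    proof -
      have "\<tau> y \<in> succs G y" "st (\<mu> (\<tau> y)) y \<le> \<mu> y" if "y \<in> pos0 G"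
        using \<tau> that \<open>y \<in> U\<close> assms(5)
        by (auto simp: strategies_def owned_def progress_measure_def)
      then show "f y \<in> succs G y" "st (\<mu> (f y)) y \<le> \<mu> y"
        using \<sigma>[of y] \<open>y \<in> U\<close> U_sub by (auto simp: f_def owned_def positions_def)
    qed
    have f_U: "f y \<in> U" if "y \<in> U" for y
      using D1_step[OF assms(2-4), of y \<mu> "f y"] f_succ[OF that] f_step[OF that] that
        succs_subset_positions[OF assms(1), of y] by (auto simp: U_def)
    have x_U: "x n \<in> U" for n
      by (induction n) (simp_all add: x_def \<open>v \<in> U\<close> f_U)
    have play: "play G U \<tau> ?\<sigma> v n = Some (x n)" for n
    proof (induction n)
      case 0
      show ?case by (simp add: x_def)
    next
      case (Suc n)
      have "x (Suc n) = f (x n)"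
        by (simp add: x_def)
      with Suc x_U[of "Suc n"] show ?case
        by (simp add: f_def Let_def del: restrict_apply One_nat_def split: if_splits)
    qed
    have "odd (play_priority G (play G U \<tau> ?\<sigma> v))"
      unfolding play_priority_Some[OF play]
      using progressing_path_odd[OF assms(1-3), of x \<mu>] x_U f_step
      by (simp add: U_def x_def)
    moreover have "infinite_play (play G U \<tau> ?\<sigma> v)"
      unfolding infinite_play_def play by simp
    ultimately show ?thesis
      by (simp add: odd_iff_mod_2_eq_one)
  qed
  ultimately show ?thesis
    by (simp add: winning_on_def Let_def)
qed

lemma ex_coherent:
  assumes "progress_measure G st \<mu>"
  shows "\<exists>\<sigma>. coherent G st \<mu> \<sigma>"
proof -
  obtain \<sigma> where "\<And>v. v \<in> pos1 G \<Longrightarrow> \<sigma> v \<in> succs G v \<and> st (\<mu> (\<sigma> v)) v \<le> \<mu> v"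
    using assms unfolding progress_measure_def by metis
  \<comment> \<open>Restricting makes the chosen function extensional, as membership in
    \<open>strategies\<close> demands.\<close>
  then have "coherent G st \<mu> (restrict \<sigma> (pos1 G))"
    by (auto simp: coherent_def strategies_def owned_def positions_def)
  then show ?thesis
    by blast
qed

theorem theorem7:
  fixes G :: "'v game"
    and tr st :: "'m::{linorder,order_bot,order_top} \<Rightarrow> 'v \<Rightarrow> 'm"
    and \<mu> :: "'v \<Rightarrow> 'm"
  assumes "parity_game G"
    and "progress_measure_space G tr st"
    and "canonical_truncation G tr"
    and "top_stretch G st"
    and "progress_measure G st \<mu>"
  shows "dominion G 1 (D1 G tr \<mu>) \<and>
    (\<forall>\<sigma>. coherent G st \<mu> \<sigma> \<longrightarrow>
       winning_on G 1 (D1 G tr \<mu>) (restrict \<sigma> (D1 G tr \<mu> \<inter> owned G 1)))"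
proof -
  have "D1 G tr \<mu> \<subseteq> positions G"
    by (simp add: D1_def)
  then show ?thesis
    using coherent_winning[OF assms] ex_coherent[OF assms(5)] by (auto simp: dominion_def)
qed

end
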